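(* Let $G$ be a finite, simple, connected graph on $n$ vertices with $m \le 2n-1$ edges and maximum degree $\Delta(G) \le 4$. Then $a'(G) \le 6$.
   Context: A proper edge coloring of a graph assigns colors to edges so that adjacent edges (edges sharing an endpoint) receive different colors. It is acyclic if there is no bichromatic cycle, i.e. no cycle whose edges use only two colors. The acyclic chromatic index $a'(G)$ is the minimum number of colors in an acyclic edge coloring of $G$. *)

theory Defs
  imports Main
begin

definition simple_graph :: "'a set \<Rightarrow> 'a set set \<Rightarrow> bool" where
  "simple_graph V E \<longleftrightarrow> finite V \<and> (\<forall>e\<in>E. e \<subseteq> V \<and> card e = 2)"

definition degree :: "'a set set \<Rightarrow> 'a \<Rightarrow> nat" where
  "degree E v = card {e \<in> E. v \<in> e}"

definition is_walk :: "'a set set \<Rightarrow> 'a list \<Rightarrow> bool" where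
  "is_walk E xs \<longleftrightarrow> xs \<noteq> [] \<and> (\<forall>i. Suc i < length xs \<longrightarrow> {xs ! i, xs ! Suc i} \<in> E)"

definition connected_graph :: "'a set \<Rightarrow> 'a set set \<Rightarrow> bool" where
  "connected_graph V E \<longleftrightarrow>
     (\<forall>u\<in>V. \<forall>v\<in>V. \<exists>xs. is_walk E xs \<and> hd xs = u \<and> last xs = v)"

definition cycle_edges :: "'a list \<Rightarrow> 'a set set" where
  "cycle_edges xs = {{xs ! i, xs ! ((Suc i) mod length xs)} | i. i < length xs}"

definition is_cycle :: "'a set set \<Rightarrow> 'a list \<Rightarrow> bool" where
  "is_cycle E xs \<longleftrightarrow> length xs \<ge> 3 \<and> distinct xs \<and> cycle_edges xs \<subseteq> E"

definition proper_edge_coloring :: "'a set set \<Rightarrow> ('a set \<Rightarrow> nat) \<Rightarrow> nat \<Rightarrow> bool" where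
  "proper_edge_coloring E c k \<longleftrightarrow>
     (\<forall>e\<in>E. c e < k) \<and> (\<forall>e\<in>E. \<forall>f\<in>E. e \<noteq> f \<and> e \<inter> f \<noteq> {} \<longrightarrow> c e \<noteq> c f)"

definition acyclic_edge_coloring :: "'a set set \<Rightarrow> ('a set \<Rightarrow> nat) \<Rightarrow> nat \<Rightarrow> bool" where
  "acyclic_edge_coloring E c k \<longleftrightarrow> proper_edge_coloring E c k \<and>
     (\<forall>xs. is_cycle E xs \<longrightarrow> card (c ` cycle_edges xs) > 2)"

definition acyclic_chromatic_index :: "'a set \<Rightarrow> 'a set set \<Rightarrow> nat" where
  "acyclic_chromatic_index V E = (LEAST k. \<exists>c. acyclic_edge_coloring E c k)"

end

theory Submission
  imports Defs
begin

text \<open>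
  A connected graph with maximum degree 4 and fewer than \<open>2n\<close> edges is 3-degenerate, so remove a
  vertex \<open>v\<close> of degree at most 3 and colour the rest by induction. Let \<open>S\<^sub>i\<close> be the set of at least
  three colours missing at the neighbour \<open>u\<^sub>i\<close> of \<open>v\<close>. Colours \<open>a\<^sub>i \<in> S\<^sub>i\<close> for the edges \<open>vu\<^sub>i\<close> close a
  bichromatic cycle through \<open>u\<^sub>i\<close> and \<open>u\<^sub>j\<close> only if \<open>a\<^sub>i \<notin> S\<^sub>j\<close>, \<open>a\<^sub>j \<notin> S\<^sub>i\<close> and an alternating chain joins
  \<open>u\<^sub>i\<close> to \<open>u\<^sub>j\<close>. If the \<open>S\<^sub>i\<close> pairwise meet, a choice without such a pair exists.

  Otherwise, up to relabelling, \<open>S\<^sub>1\<close> and \<open>S\<^sub>2\<close> are complementary 3-sets and \<open>S\<^sub>3\<close> has two colours in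
  common with \<open>S\<^sub>1\<close>. Chains from \<open>u\<^sub>2\<close> are deterministic, so if no choice works, then for each
  \<open>b \<in> S\<^sub>2\<close> all \<open>(r,b)\<close>-chains from \<open>u\<^sub>2\<close>, \<open>r \<in> S\<^sub>1\<close>, end at one vertex, \<open>u\<^sub>1\<close> or (when \<open>S\<^sub>3 = S\<^sub>1\<close>) \<open>u\<^sub>3\<close>.
  Two of the three \<open>b\<close> share this vertex, say \<open>u\<^sub>1\<close>. The far ends of the two edges at \<open>u\<^sub>1\<close> with these
  colours have degree 4 and see exactly \<open>S\<^sub>1\<close> on their other edges. Hence exchanging the
  two colours creates no bichromatic cycle, while it cuts the chains.
\<close>

section \<open>Colours at a vertex and alternating chains\<close>

definition colors_at :: "'a set set \<Rightarrow> ('a set \<Rightarrow> nat) \<Rightarrow> 'a \<Rightarrow> nat set" where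
  "colors_at E c v = c ` {e \<in> E. v \<in> e}"

text \<open>A step covers two edges, so that under a proper colouring the relation is a partial
  function. A nonempty chain from \<open>x\<close> to \<open>y\<close> leaves \<open>x\<close> by an
  \<alpha>-edge and enters \<open>y\<close> by a \<beta>-edge.\<close>

definition alt_step :: "'a set set \<Rightarrow> ('a set \<Rightarrow> nat) \<Rightarrow> nat \<Rightarrow> nat \<Rightarrow> ('a \<times> 'a) set" where
  "alt_step E c \<alpha> \<beta> =
     {(x, z). \<exists>y. {x, y} \<in> E \<and> c {x, y} = \<alpha> \<and> {y, z} \<in> E \<and> c {y, z} = \<beta>}"

text \<open>
  \<open>N\<close> plays the role of the neighbourhood of a removed vertex \<open>v\<close>, and \<open>f u\<close> is the colour intended
  for the edge \<open>vu\<close>. The colouring of the remaining edges \<open>E\<close> may be changed.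
\<close>
definition extendable :: "'a set set \<Rightarrow> 'a set \<Rightarrow> bool" where
  "extendable E N \<longleftrightarrow> (\<exists>c f. acyclic_edge_coloring E c 6 \<and>
     (\<forall>u\<in>N. f u < 6 \<and> f u \<notin> colors_at E c u) \<and>
     (\<forall>u\<in>N. \<forall>w\<in>N. u \<noteq> w \<longrightarrow> f u \<noteq> f w \<and> (w, u) \<notin> (alt_step E c (f u) (f w))\<^sup>*))"

lemma colors_atI: "{v, x} \<in> E \<Longrightarrow> c {v, x} \<in> colors_at E c v"
  "{x, v} \<in> E \<Longrightarrow> c {x, v} \<in> colors_at E c v"
  by (auto simp: colors_at_def)

lemma colors_atE:
  assumes "\<forall>e\<in>E. card e = 2" "r \<in> colors_at E c v"
  obtains x where "{v, x} \<in> E" "c {v, x} = r" "x \<noteq> v"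
proof -
  obtain e where e: "e \<in> E" "v \<in> e" "c e = r"
    using assms(2) by (auto simp: colors_at_def)
  with assms(1) have "card e = 2" by blast
  then obtain x where "e = {v, x}" "x \<noteq> v"
    using e(2) unfolding card_2_iff by blast
  with e that show ?thesis by blast
qed

lemma card_colors_at_le:
  assumes "finite E"
  shows "card (colors_at E c v) \<le> degree E v"
  unfolding colors_at_def degree_def using assms by (intro card_image_le) auto

lemma finite_colors_at: "finite E \<Longrightarrow> finite (colors_at E c v)"
  by (simp add: colors_at_def)

lemma proper_edge_neq:
  assumes "proper_edge_coloring E c k" "e \<in> E" "f \<in> E" "e \<noteq> f" "e \<inter> f \<noteq> {}"
  shows "c e \<noteq> c f"
  using assms unfolding proper_edge_coloring_def by simp

lemma proper_edge_inj:
  assumes "proper_edge_coloring E c k" "{x, y} \<in> E" "{x, z} \<in> E" "c {x, y} = c {x, z}"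
  shows "y = z"
proof -
  have "{x, y} = {x, z}"
    using assms unfolding proper_edge_coloring_def by (metis disjoint_insert(1) insertI1)
  then show ?thesis by (auto simp: doubleton_eq_iff)
qed

lemma alt_step_single_valued:
  assumes "proper_edge_coloring E c k"
  shows "single_valued (alt_step E c \<alpha> \<beta>)"
proof (rule single_valuedI)
  fix x z z'
  assume "(x, z) \<in> alt_step E c \<alpha> \<beta>" "(x, z') \<in> alt_step E c \<alpha> \<beta>"
  then obtain y y' where
    y: "{x, y} \<in> E" "c {x, y} = \<alpha>" "{y, z} \<in> E" "c {y, z} = \<beta>" and
    y': "{x, y'} \<in> E" "c {x, y'} = \<alpha>" "{y', z'} \<in> E" "c {y', z'} = \<beta>"
    by (auto simp: alt_step_def)
  have "y = y'" using proper_edge_inj[OF assms y(1) y'(1)] y y' by simp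
  then show "z = z'" using proper_edge_inj[OF assms y(3)] y y' by simp
qed

lemma alt_step_converse: "(alt_step E c \<alpha> \<beta>)\<inverse> = alt_step E c \<beta> \<alpha>"
  unfolding alt_step_def by (auto simp: insert_commute)

lemma alt_reach_commute:
  "(x, y) \<in> (alt_step E c \<alpha> \<beta>)\<^sup>* \<longleftrightarrow> (y, x) \<in> (alt_step E c \<beta> \<alpha>)\<^sup>*"
  by (metis alt_step_converse rtrancl_converseD rtrancl_converseI)

text \<open>A chain between distinct vertices has a first and a last edge. Mostly used in reverse: a
  colour missing at one end excludes the chain.\<close>

lemma alt_reach_colors:
  assumes "(x, y) \<in> (alt_step E c \<alpha> \<beta>)\<^sup>*" "x \<noteq> y"
  shows "\<alpha> \<in> colors_at E c x" "\<beta> \<in> colors_at E c y"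
proof -
  from assms obtain z where "(x, z) \<in> alt_step E c \<alpha> \<beta>"
    by (meson converse_rtranclE)
  then show "\<alpha> \<in> colors_at E c x" by (auto simp: alt_step_def intro: colors_atI)
  from assms obtain z where "(z, y) \<in> alt_step E c \<alpha> \<beta>"
    by (meson rtranclE)
  then show "\<beta> \<in> colors_at E c y" by (auto simp: alt_step_def intro: colors_atI)
qed

text \<open>The chain from \<open>x\<close> is deterministic, so it can get stuck at one vertex
  only.\<close>

lemma alt_reach_unique:
  assumes "proper_edge_coloring E c k"
    and "(x, y) \<in> (alt_step E c \<alpha> \<beta>)\<^sup>*" "y \<notin> Domain (alt_step E c \<alpha> \<beta>)"
    and "(x, z) \<in> (alt_step E c \<alpha> \<beta>)\<^sup>*" "z \<notin> Domain (alt_step E c \<alpha> \<beta>)"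
  shows "y = z"
proof -
  have "(y, z) \<in> (alt_step E c \<alpha> \<beta>)\<^sup>* \<or> (z, y) \<in> (alt_step E c \<alpha> \<beta>)\<^sup>*"
    using single_valued_confluent[OF alt_step_single_valued[OF assms(1)] assms(2,4)] .
  then show ?thesis using assms(3,5) by (metis Not_Domain_rtrancl)
qed

lemma not_Domain_alt_step:
  "\<alpha> \<notin> colors_at E c x \<Longrightarrow> x \<notin> Domain (alt_step E c \<alpha> \<beta>)"
  by (auto simp: alt_step_def dest: colors_atI)

section \<open>Bichromatic cycles through a vertex\<close>

lemma cycle_rotate_to:
  assumes "is_cycle E xs" "v \<in> set xs"
  obtains ys where "is_cycle E ys" "ys ! 0 = v" "cycle_edges ys \<subseteq> cycle_edges xs"
proof -
  let ?n = "length xs"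
  obtain m where m: "m < ?n" "xs ! m = v" using assms(2) by (auto simp: in_set_conv_nth)
  let ?ys = "rotate m xs"
  have n: "?n \<ge> 3" using assms(1) by (simp add: is_cycle_def)
  have sub: "cycle_edges ?ys \<subseteq> cycle_edges xs"
  proof
    fix e assume "e \<in> cycle_edges ?ys"
    then obtain i where i: "i < ?n" "e = {?ys ! i, ?ys ! (Suc i mod ?n)}"
      by (auto simp: cycle_edges_def)
    have "?ys ! (Suc i mod ?n) = xs ! ((m + Suc i mod ?n) mod ?n)"
      using n by (intro nth_rotate mod_less_divisor) linarith
    also have "(m + Suc i mod ?n) mod ?n = Suc ((m + i) mod ?n) mod ?n"
      by (simp add: mod_simps)
    finally have "e = {xs ! ((m + i) mod ?n), xs ! (Suc ((m + i) mod ?n) mod ?n)}"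
      using i by (simp add: nth_rotate)
    moreover have "(m + i) mod ?n < ?n" using n by (intro mod_less_divisor) auto
    ultimately show "e \<in> cycle_edges xs" unfolding cycle_edges_def by blast
  qed
  have "?ys ! 0 = v" using m n by (subst nth_rotate) auto
  moreover have "is_cycle E ?ys" using assms(1) sub by (auto simp: is_cycle_def)
  ultimately show ?thesis using sub that by blast
qed

text \<open>The colours alternate along the cycle, so deleting \<open>v\<close> leaves a chain
  between its two cycle neighbours. The rotated cycle \<open>ys\<close> is returned too, since the
  exchange argument must know which edges at \<open>v\<close> it uses.\<close>

lemma bichromatic_cycle_through:
  assumes proper: "proper_edge_coloring E c k"
    and cyc: "is_cycle E xs" "v \<in> set xs" "card (c ` cycle_edges xs) \<le> 2"
  obtains p q ys where "{v, p} \<in> E" "{v, q} \<in> E" "p \<noteq> q"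
    "(p, q) \<in> (alt_step {e \<in> E. v \<notin> e} c (c {v, q}) (c {v, p}))\<^sup>*"
    "is_cycle E ys" "cycle_edges ys \<subseteq> cycle_edges xs"
    "\<forall>g\<in>cycle_edges ys. v \<in> g \<longrightarrow> g = {v, p} \<or> g = {v, q}"
proof -
  obtain ys where ys: "is_cycle E ys" "ys ! 0 = v" "cycle_edges ys \<subseteq> cycle_edges xs"
    using cycle_rotate_to[OF cyc(1,2)] .
  let ?n = "length ys"
  define e where "e i = {ys ! i, ys ! (Suc i mod ?n)}" for i
  have n: "?n \<ge> 3" and dist: "distinct ys" and ce: "cycle_edges ys \<subseteq> E"
    using ys(1) by (auto simp: is_cycle_def)
  have lt: "0 < ?n" "?n - 1 < ?n" using n by linarith+
  have eC: "e i \<in> cycle_edges ys" if "i < ?n" for i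
    using that unfolding e_def cycle_edges_def by blast
  have eE: "e i \<in> E" if "i < ?n" for i using eC[OF that] ce by blast
  have eS: "e i = {ys ! i, ys ! Suc i}" if "Suc i < ?n" for i
    using that by (simp add: e_def)
  have elast: "e (?n - 1) = {v, ys ! (?n - 1)}"
  proof -
    have "Suc (?n - 1) = ?n" using n by linarith
    then have "Suc (?n - 1) mod ?n = 0" by (metis mod_self)
    then show ?thesis using ys(2) by (simp add: e_def insert_commute)
  qed
  have e0: "e 0 = {v, ys ! 1}" using n ys(2) eS[of 0] by simp
  define \<alpha> where "\<alpha> = c (e 0)"
  define \<beta> where "\<beta> = c (e (?n - 1))"
  have neq: "ys ! i \<noteq> ys ! j" if "i < ?n" "j < ?n" "i \<noteq> j" for i j
    using that dist by (simp add: nth_eq_iff_index_eq)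
  have pq: "ys ! 1 \<noteq> ys ! (?n - 1)" using neq n by simp
  have ab: "\<alpha> \<noteq> \<beta>"
    using proper_edge_inj[OF proper, of v "ys ! 1" "ys ! (?n - 1)"] eE[of 0] eE[of "?n - 1"]
      e0 elast pq lt by (auto simp: \<alpha>_def \<beta>_def)
  have fin: "finite (c ` cycle_edges ys)" "finite (c ` cycle_edges xs)"
    by (auto simp: cycle_edges_def)
  have "card (c ` cycle_edges ys) \<le> 2"
    using cyc(3) card_mono[OF fin(2) image_mono[OF ys(3)]] by linarith
  moreover have "{\<alpha>, \<beta>} \<subseteq> c ` cycle_edges ys"
    using eC[OF lt(1)] eC[OF lt(2)] by (auto simp: \<alpha>_def \<beta>_def)
  ultimately have im: "c ` cycle_edges ys = {\<alpha>, \<beta>}"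
    using card_seteq[OF fin(1), of "{\<alpha>, \<beta>}"] ab by simp
  have two: "c (e i) = \<alpha> \<or> c (e i) = \<beta>" if "i < ?n" for i
    using eC[OF that] im by blast
  \<comment> \<open>Edge \<open>e (Suc i)\<close> may be the closing one; length at least 3 keeps
    its other end distinct from \<open>ys ! i\<close> even after wrapping around.\<close>
  have succ: "c (e (Suc i)) \<noteq> c (e i)" if "Suc i < ?n" for i
  proof
    assume eq: "c (e (Suc i)) = c (e i)"
    have 1: "e i = {ys ! Suc i, ys ! i}" using eS[OF that] by (simp add: insert_commute)
    have 2: "e (Suc i) = {ys ! Suc i, ys ! (Suc (Suc i) mod ?n)}" by (simp add: e_def)
    have "ys ! i = ys ! (Suc (Suc i) mod ?n)"
      using proper_edge_inj[OF proper, of "ys ! Suc i"] eq 1 2 eE[of i] eE[of "Suc i"] that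
      by simp
    moreover have "Suc (Suc i) mod ?n \<noteq> i"
      using that n by (cases "Suc (Suc i) = ?n") auto
    moreover have "Suc (Suc i) mod ?n < ?n" using n by (intro mod_less_divisor) auto
    ultimately show False using neq[of i "Suc (Suc i) mod ?n"] that by simp
  qed
  have col: "c (e i) = (if even i then \<alpha> else \<beta>)" if "i < ?n" for i
    using that
  proof (induction i)
    case (Suc i)
    then show ?case using two[of "Suc i"] succ[of i] by auto
  qed (simp add: \<alpha>_def)
  \<comment> \<open>The closing edge has colour \<beta>, so its index is odd and the path from
    \<open>ys ! 1\<close> to \<open>ys ! (?n - 1)\<close> splits into two-edge steps.\<close>
  have odd_last: "odd (?n - 1)" using col[OF lt(2)] ab \<beta>_def by metis
  let ?R = "alt_step {e \<in> E. v \<notin> e} c \<beta> \<alpha>"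
  have edge: "{ys ! i, ys ! Suc i} \<in> {e \<in> E. v \<notin> e}" if "Suc i < ?n" "i > 0" for i
    using eE[of i] eS[of i] that neq[OF lt(1), of i] neq[OF lt(1), of "Suc i"] ys(2) by auto
  have reach: "(ys ! 1, ys ! Suc (2 * j)) \<in> ?R\<^sup>*" if "Suc (2 * j) < ?n" for j
    using that
  proof (induction j)
    case (Suc j)
    have "(ys ! Suc (2 * j), ys ! Suc (Suc (Suc (2 * j)))) \<in> ?R"
      using edge[of "Suc (2 * j)"] edge[of "Suc (Suc (2 * j))"] Suc.prems
        col[of "Suc (2 * j)"] col[of "Suc (Suc (2 * j))"]
        eS[of "Suc (2 * j)"] eS[of "Suc (Suc (2 * j))"]
      unfolding alt_step_def by auto
    with Suc show ?case by (auto intro: rtrancl_into_rtrancl)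
  qed simp
  obtain j where "?n - 1 = Suc (2 * j)" using odd_last by (metis oddE Suc_eq_plus1)
  with reach[of j] n have "(ys ! 1, ys ! (?n - 1)) \<in> ?R\<^sup>*" by auto
  moreover have at_v: "g = {v, ys ! 1} \<or> g = {v, ys ! (?n - 1)}"
    if g: "g \<in> cycle_edges ys" "v \<in> g" for g
  proof -
    obtain i where i: "i < ?n" "g = e i" using g(1) by (auto simp: cycle_edges_def e_def)
    have "Suc i mod ?n < ?n" using lt by simp
    then have "i = 0 \<or> Suc i mod ?n = 0"
      using g(2) i neq[OF lt(1), of i] neq[OF lt(1), of "Suc i mod ?n"] ys(2) by (auto simp: e_def)
    then have "i = 0 \<or> i = ?n - 1" using i(1) by (auto simp: mod_Suc split: if_splits)
    then show ?thesis using e0 elast i(2) by metis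
  qed
  ultimately show ?thesis
    using that[of "ys ! 1" "ys ! (?n - 1)" ys] pq e0 elast eE[OF lt(1)] eE[OF lt(2)] ys
    by (simp add: \<alpha>_def \<beta>_def)
qed

lemma cycle_edges_subset_set: "e \<in> cycle_edges xs \<Longrightarrow> e \<subseteq> set xs"
  unfolding cycle_edges_def
  by (auto intro!: nth_mem mod_less_divisor)

section \<open>Extending a colouring to a removed vertex\<close>

text \<open>A bichromatic cycle avoiding \<open>v\<close> would exist already in the smaller graph;
  one through \<open>v\<close> would leave a chain that \<open>extendable\<close> forbids. Only an
  inclusion in \<open>N\<close> is asked for, so \<open>N\<close> may be padded to three
  vertices.\<close>

lemma acyclic_edge_coloring_extend:
  assumes card2: "\<forall>e\<in>E. card e = 2"
    and ext: "extendable {e \<in> E. v \<notin> e} N"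
    and N: "{u. {v, u} \<in> E} \<subseteq> N"
  shows "\<exists>c. acyclic_edge_coloring E c 6"
proof -
  let ?E' = "{e \<in> E. v \<notin> e}"
  obtain c f where ac: "acyclic_edge_coloring ?E' c 6"
    and f: "\<And>u. u \<in> N \<Longrightarrow> f u < 6 \<and> f u \<notin> colors_at ?E' c u"
    and ff: "\<And>u w. u \<in> N \<Longrightarrow> w \<in> N \<Longrightarrow> u \<noteq> w \<Longrightarrow>
      f u \<noteq> f w \<and> (w, u) \<notin> (alt_step ?E' c (f u) (f w))\<^sup>*"
    using ext unfolding extendable_def by blast
  have pc: "proper_edge_coloring ?E' c 6" using ac by (simp add: acyclic_edge_coloring_def)
  \<comment> \<open>Edges are sets: \<open>the_elem (e - {v})\<close> is the other end of an edge at
    \<open>v\<close>.\<close>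
  define c' where "c' e = (if v \<in> e then f (the_elem (e - {v})) else c e)" for e
  have c'v: "c' {v, u} = f u" if "{v, u} \<in> E" for u
  proof -
    have "{v, u} - {v} = {u}" using card2 that by fastforce
    then show ?thesis by (simp add: c'_def)
  qed
  have old: "c' e = c e" if "v \<notin> e" for e using that by (simp add: c'_def)
  have ev: "\<exists>u\<in>N. e = {v, u} \<and> c' e = f u" if e: "e \<in> E" "v \<in> e" for e
  proof -
    from card2 e have "card e = 2" by blast
    then obtain u where "e = {v, u}" using e(2) unfolding card_2_iff by blast
    then show ?thesis using N e c'v by blast
  qed
  have mixed: "c' e \<noteq> c' g" if eg: "e \<in> E" "g \<in> E" "v \<in> e" "v \<notin> g" "e \<inter> g \<noteq> {}" for e g
  proof -
    obtain u where u: "u \<in> N" "e = {v, u}" "c' e = f u" using ev eg by blast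
    then have "c g \<in> colors_at ?E' c u" using eg by (auto simp: colors_at_def)
    then show ?thesis using f u old eg by metis
  qed
  have proper: "proper_edge_coloring E c' 6"
    unfolding proper_edge_coloring_def
  proof (intro conjI ballI impI)
    fix e assume e: "e \<in> E"
    show "c' e < 6"
      using e ev[of e] f pc old[of e] unfolding proper_edge_coloring_def
      by (cases "v \<in> e") force+
  next
    fix e g assume e: "e \<in> E" and g: "g \<in> E" and ne: "e \<noteq> g \<and> e \<inter> g \<noteq> {}"
    consider "v \<in> e" "v \<in> g" | "v \<in> e" "v \<notin> g" | "v \<notin> e" "v \<in> g" | "v \<notin> e" "v \<notin> g" by blast
    then show "c' e \<noteq> c' g"
    proof cases
      case 1
      with ev e g ne ff show ?thesis by metis
    next
      case 2
      with mixed e g ne show ?thesis by blast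
    next
      case 3
      with mixed[of g e] e g ne show ?thesis by (metis Int_commute)
    next
      case 4
      with pc e g ne old show ?thesis unfolding proper_edge_coloring_def by simp
    qed
  qed
  have step: "alt_step ?E' c' \<alpha> \<beta> = alt_step ?E' c \<alpha> \<beta>" for \<alpha> \<beta>
    unfolding alt_step_def using old by auto
  have "card (c' ` cycle_edges xs) > 2" if cyc: "is_cycle E xs" for xs
  proof (rule ccontr)
    assume "\<not> ?thesis"
    then have le: "card (c' ` cycle_edges xs) \<le> 2" by simp
    show False
    proof (cases "v \<in> set xs")
      case True
      obtain p q where "{v, p} \<in> E" "{v, q} \<in> E" "p \<noteq> q"
        "(p, q) \<in> (alt_step ?E' c' (c' {v, q}) (c' {v, p}))\<^sup>*"
        using bichromatic_cycle_through[OF proper cyc True le] .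
      then show False using ff[of q p] N c'v step by auto
    next
      case False
      then have "\<forall>e\<in>cycle_edges xs. v \<notin> e" using cycle_edges_subset_set by fastforce
      then have "is_cycle ?E' xs" "c' ` cycle_edges xs = c ` cycle_edges xs"
        using cyc old by (auto simp: is_cycle_def)
      then show False using ac le unfolding acyclic_edge_coloring_def by (metis not_less)
    qed
  qed
  with proper show ?thesis unfolding acyclic_edge_coloring_def by blast
qed

text \<open>Reversing a chain exchanges its two colours, so one orientation per pair
  suffices.\<close>

lemma extendable_tripleI:
  assumes "acyclic_edge_coloring E c 6"
    and "distinct [u1, u2, u3]" "distinct [a1, a2, a3]"
    and "a1 \<in> {..<6} - colors_at E c u1" "a2 \<in> {..<6} - colors_at E c u2"
      "a3 \<in> {..<6} - colors_at E c u3"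
    and "(u2, u1) \<notin> (alt_step E c a1 a2)\<^sup>*" "(u3, u1) \<notin> (alt_step E c a1 a3)\<^sup>*"
      "(u2, u3) \<notin> (alt_step E c a3 a2)\<^sup>*"
  shows "extendable E {u1, u2, u3}"
proof -
  have "(u1, u2) \<notin> (alt_step E c a2 a1)\<^sup>*" "(u1, u3) \<notin> (alt_step E c a3 a1)\<^sup>*"
      "(u3, u2) \<notin> (alt_step E c a2 a3)\<^sup>*"
    using assms(7-9) alt_reach_commute[of _ _ E c] by blast+
  with assms show ?thesis unfolding extendable_def
    by (intro exI[of _ c] exI[of _ "(\<lambda>_. a3)(u1 := a1, u2 := a2)"]) auto
qed


section \<open>Exchanging the colours of two edges at a vertex\<close>

definition swap_at ::
    "'a \<Rightarrow> 'a \<Rightarrow> 'a \<Rightarrow> ('a set \<Rightarrow> nat) \<Rightarrow> 'a set \<Rightarrow> nat" where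
  "swap_at u x y c = c({u, x} := c {u, y}, {u, y} := c {u, x})"

lemma swap_at_apply:
  assumes "x \<noteq> y"
  shows "swap_at u x y c {u, x} = c {u, y}" "swap_at u x y c {u, y} = c {u, x}"
    and "e \<noteq> {u, x} \<Longrightarrow> e \<noteq> {u, y} \<Longrightarrow> swap_at u x y c e = c e"
    and "u \<notin> e \<Longrightarrow> swap_at u x y c e = c e"
  using assms by (auto simp: swap_at_def doubleton_eq_iff)

lemma colors_at_swap_at:
  assumes "x \<noteq> y" "{u, x} \<in> E" "{u, y} \<in> E"
  shows "colors_at E (swap_at u x y c) u = colors_at E c u"
    and "w \<noteq> u \<Longrightarrow> w \<noteq> x \<Longrightarrow> w \<noteq> y \<Longrightarrow> colors_at E (swap_at u x y c) w = colors_at E c w"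
proof -
  let ?c = "swap_at u x y c"
  note ap = swap_at_apply[OF assms(1), where u = u and c = c]
  let ?A = "{e \<in> E. u \<in> e} - {{u, x}, {u, y}}"
  have eq: "{e \<in> E. u \<in> e} = insert {u, x} (insert {u, y} ?A)" using assms by auto
  have "?c ` ?A = c ` ?A" using ap(3) by (intro image_cong) auto
  then have "?c ` insert {u, x} (insert {u, y} ?A) = c ` insert {u, x} (insert {u, y} ?A)"
    using ap(1,2) by (auto simp only: image_insert)
  then show "colors_at E ?c u = colors_at E c u"
    unfolding colors_at_def using eq by simp
  show "colors_at E ?c w = colors_at E c w" if "w \<noteq> u" "w \<noteq> x" "w \<noteq> y"
    unfolding colors_at_def using that by (intro image_cong) (auto intro!: ap(3))
qed

text \<open>By \<open>far\<close>, the other edges at \<open>x\<close> and \<open>y\<close> have no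
  colour seen at \<open>u\<close>, and the exchange keeps the set of colours at \<open>u\<close>. So
  a cycle through an exchanged edge meets a third colour, while any other cycle keeps its
  colours.\<close>

lemma acyclic_swap_at:
  assumes ac: "acyclic_edge_coloring E c k"
    and xy: "x \<noteq> y" "{u, x} \<in> E" "{u, y} \<in> E"
    and far: "\<And>e. e \<in> E \<Longrightarrow> u \<notin> e \<Longrightarrow> x \<in> e \<or> y \<in> e \<Longrightarrow> c e \<notin> colors_at E c u"
  shows "acyclic_edge_coloring E (swap_at u x y c) k"
proof -
  let ?c = "swap_at u x y c"
  note ap = swap_at_apply[OF xy(1), where u = u and c = c]
  have pc: "proper_edge_coloring E c k" using ac by (simp add: acyclic_edge_coloring_def)
  have cu: "?c e \<in> colors_at E c u" if "e \<in> E" "u \<in> e" for e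
    using colors_at_swap_at(1)[OF xy, of c] that unfolding colors_at_def by blast
  have inj_u: "?c e \<noteq> ?c g" if eg: "e \<in> E" "g \<in> E" "u \<in> e" "u \<in> g" "e \<noteq> g" for e g
  proof -
    have inj: "c e \<noteq> c g" if "e \<in> E" "g \<in> E" "u \<in> e" "u \<in> g" "e \<noteq> g" for e g
      using pc that unfolding proper_edge_coloring_def by blast
    consider "e = {u, x}" | "e = {u, y}" | "e \<noteq> {u, x}" "e \<noteq> {u, y}" by blast
    then show ?thesis
      using eg inj xy ap(1,2) ap(3)[of e] ap(3)[of g] by cases (metis insertI1)+
  qed
  have mixed: "?c e \<noteq> ?c g" if eg: "e \<in> E" "g \<in> E" "u \<in> e" "u \<notin> g" "e \<inter> g \<noteq> {}" for e g
  proof (cases "e = {u, x} \<or> e = {u, y}")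
    case True
    then have "?c g \<notin> colors_at E c u" using far[of g] eg ap(4)[of g] by auto
    then show ?thesis using cu[of e] eg by auto
  next
    case False
    then have "?c e = c e" "?c g = c g" using ap(3)[of e] ap(4)[of g] eg by auto
    moreover have "e \<noteq> g" using eg by blast
    ultimately show ?thesis using pc eg unfolding proper_edge_coloring_def by auto
  qed
  have proper: "proper_edge_coloring E ?c k"
    unfolding proper_edge_coloring_def
  proof (intro conjI ballI impI)
    fix e assume e: "e \<in> E"
    consider "e = {u, x}" | "e = {u, y}" | "e \<noteq> {u, x}" "e \<noteq> {u, y}" by blast
    then show "?c e < k"
      using e pc xy ap(1,2) ap(3)[of e] unfolding proper_edge_coloring_def by cases auto
  next
    fix e g assume e: "e \<in> E" and g: "g \<in> E" and ne: "e \<noteq> g \<and> e \<inter> g \<noteq> {}"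
    consider "u \<in> e" "u \<in> g" | "u \<in> e" "u \<notin> g" | "u \<notin> e" "u \<in> g" | "u \<notin> e" "u \<notin> g" by blast
    then show "?c e \<noteq> ?c g"
    proof cases
      case 1
      with inj_u e g ne show ?thesis by blast
    next
      case 2
      with mixed e g ne show ?thesis by blast
    next
      case 3
      with mixed[of g e] e g ne show ?thesis by (metis Int_commute)
    next
      case 4
      with pc e g ne ap(4) show ?thesis unfolding proper_edge_coloring_def by simp
    qed
  qed
  have blocked: False
    if z: "z = x \<or> z = y" and w: "{u, w} \<in> E" and r: "?c {u, w} \<in> colors_at {e \<in> E. u \<notin> e} ?c z"
    for z w
  proof -
    obtain e where "e \<in> E" "u \<notin> e" "z \<in> e" "?c {u, w} = ?c e"
      using r by (auto simp: colors_at_def)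
    then show False using far[of e] z ap(4)[of e] cu[OF w] by auto
  qed
  have "card (?c ` cycle_edges xs) > 2" if cyc: "is_cycle E xs" for xs
  proof (rule ccontr)
    assume "\<not> ?thesis"
    then have le: "card (?c ` cycle_edges xs) \<le> 2" by simp
    show False
    proof (cases "u \<in> set xs")
      case True
      obtain p q ys where pq: "{u, p} \<in> E" "{u, q} \<in> E" "p \<noteq> q"
        "(p, q) \<in> (alt_step {e \<in> E. u \<notin> e} ?c (?c {u, q}) (?c {u, p}))\<^sup>*"
        and ys: "is_cycle E ys" "cycle_edges ys \<subseteq> cycle_edges xs"
        and at_u: "\<forall>g\<in>cycle_edges ys. u \<in> g \<longrightarrow> g = {u, p} \<or> g = {u, q}"
        using bichromatic_cycle_through[OF proper cyc True le] .
      \<comment> \<open>The chain begins and ends with colours of edges at \<open>u\<close>, hence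
        neither end is \<open>x\<close> or \<open>y\<close>, and the cycle avoids both exchanged
        edges.\<close>
      note cols = alt_reach_colors[OF pq(4,3)]
      have "p \<noteq> x" "p \<noteq> y" using blocked[OF _ pq(2) cols(1)] by auto
      moreover have "q \<noteq> x" "q \<noteq> y" using blocked[OF _ pq(1) cols(2)] by auto
      ultimately have "g \<noteq> {u, x} \<and> g \<noteq> {u, y}" if "g \<in> cycle_edges ys" for g
        using at_u that by (fastforce simp: doubleton_eq_iff)
      then have "?c ` cycle_edges ys = c ` cycle_edges ys" using ap(3) by (intro image_cong) auto
      then have "2 < card (?c ` cycle_edges ys)"
        using ac ys(1) by (auto simp: acyclic_edge_coloring_def)
      moreover have "card (?c ` cycle_edges ys) \<le> card (?c ` cycle_edges xs)"
        using ys(2) by (intro card_mono image_mono) (auto simp: cycle_edges_def)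
      ultimately show False using le by linarith
    next
      case False
      then have "\<forall>e\<in>cycle_edges xs. u \<notin> e" using cycle_edges_subset_set by fastforce
      then have "?c ` cycle_edges xs = c ` cycle_edges xs" using ap(4) by (intro image_cong) auto
      then show False using ac cyc le by (auto simp: acyclic_edge_coloring_def)
    qed
  qed
  with proper show ?thesis unfolding acyclic_edge_coloring_def by blast
qed

text \<open>The old chain from \<open>s\<close> gets stuck only at \<open>u\<close>, entered through
  \<open>x\<close>. Every new chain from \<open>s\<close> retraces the old one and can no longer
  enter \<open>u\<close>, so it cannot reach \<open>t\<close>, where the old chain would be stuck as
  well.\<close>

lemma swap_at_breaks_reach:
  assumes proper: "proper_edge_coloring E c k"
    and xy: "x \<noteq> y" "{u, x} \<in> E" "{u, y} \<in> E"
    and su: "(s, u) \<in> (alt_step E c r (c {u, x}))\<^sup>*" "s \<noteq> u"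
    and r: "r \<notin> colors_at E c u"
    and y: "c {u, x} \<notin> colors_at E c y"
    and t: "r \<notin> colors_at E c t"
  shows "(s, t) \<notin> (alt_step E (swap_at u x y c) r (c {u, x}))\<^sup>*"
proof
  let ?b = "c {u, x}" and ?c = "swap_at u x y c"
  let ?S = "alt_step E c r ?b"
  note ap = swap_at_apply[OF xy(1), where u = u and c = c]
  note terminal = alt_reach_unique[OF proper su(1) not_Domain_alt_step[OF r]]
  have rold: "c e = r" if "?c e = r" "e \<in> E" for e
  proof -
    have "e \<noteq> {u, x}" "e \<noteq> {u, y}" using that r xy ap(1,2) colors_atI(1)[of u] by metis+
    then show ?thesis using ap(3)[of e] that by simp
  qed
  assume "(s, t) \<in> (alt_step E ?c r ?b)\<^sup>*"
  then have "(s, t) \<in> ?S\<^sup>* \<and> t \<noteq> u"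
  proof (induction rule: rtrancl_induct)
    case (step w w')
    obtain z where z: "{w, z} \<in> E" "?c {w, z} = r" "{z, w'} \<in> E" "?c {z, w'} = ?b"
      using step.hyps(2) by (auto simp: alt_step_def)
    have wz: "c {w, z} = r" using rold z by blast
    have zu: "z \<noteq> u" using wz z(1) r colors_atI(2) by metis
    have nux: "{z, w'} \<noteq> {u, x}"
    proof
      assume "{z, w'} = {u, x}"
      then have "c {u, y} = c {u, x}" using z(4) ap(1) by simp
      then show False using proper_edge_inj[OF proper xy(2,3)] xy(1) by simp
    qed
    have nuy: "{z, w'} \<noteq> {u, y}"
    proof
      assume "{z, w'} = {u, y}"
      then have "z = y" using zu by (auto simp: doubleton_eq_iff)
      \<comment> \<open>The \<open>r\<close>-edge at \<open>w\<close> leads to \<open>y\<close>,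
        where \<open>?b\<close> was missing, so the old chain is stuck at \<open>w\<close>. This
        forces \<open>w = u\<close>, against the induction hypothesis.\<close>
      have "w \<notin> Domain ?S"
      proof
        assume "w \<in> Domain ?S"
        then obtain z' w'' where "{w, z'} \<in> E" "c {w, z'} = r" "{z', w''} \<in> E" "c {z', w''} = ?b"
          by (auto simp: alt_step_def)
        moreover from this have "z' = z" using proper_edge_inj[OF proper] z(1) wz by metis
        ultimately show False using y \<open>z = y\<close> colors_atI(1) by metis
      qed
      then show False using terminal step.IH by blast
    qed
    have old: "c {z, w'} = ?b" using ap(3)[OF nux nuy] z(4) by simp
    have "w' \<noteq> u"
    proof
      assume "w' = u"
      then have "{u, z} \<in> E" "c {u, z} = ?b" using z(3) old by (auto simp: insert_commute)
      then have "z = x" using proper_edge_inj[OF proper _ xy(2)] by blast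
      then show False using nux \<open>w' = u\<close> by auto
    qed
    moreover have "(w, w') \<in> ?S" using z wz old by (auto simp: alt_step_def)
    ultimately show ?case using step.IH by auto
  qed (use su in auto)
  then show False using terminal not_Domain_alt_step[OF t] by blast
qed


section \<open>Colouring the edges to three neighbours\<close>

text \<open>Exchanging \<open>b\<close> and \<open>b'\<close> at \<open>u1\<close> cuts the chains
  using \<open>b\<close>. Then \<open>b\<close> serves \<open>u2\<close>, and two colours of
  \<open>S1\<close> missing at \<open>u3\<close> serve \<open>u1\<close> and
  \<open>u3\<close>.\<close>

lemma extendable_by_swap:
  assumes card2: "\<forall>e\<in>E. card e = 2" and fin: "finite E"
    and deg: "\<And>v. degree E v \<le> 4" "degree E u3 \<le> 3"
    and ac: "acyclic_edge_coloring E c 6"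
    and dist: "distinct [u1, u2, u3]"
    and S1: "S1 = {..<6} - colors_at E c u1" "card S1 = 3"
    and S2: "S2 = {..<6} - colors_at E c u2" "card S2 = 3"
    and cols: "colors_at E c u1 = S2" "colors_at E c u2 = S1"
    and meet: "2 \<le> card (S1 - colors_at E c u3)"
    and b: "b \<in> S2" "b' \<in> S2" "b \<noteq> b'"
    and reach: "\<And>r. r \<in> S1 \<Longrightarrow> (u2, u1) \<in> (alt_step E c r b)\<^sup>*"
      "\<And>r. r \<in> S1 \<Longrightarrow> (u2, u1) \<in> (alt_step E c r b')\<^sup>*"
  shows "extendable E {u1, u2, u3}"
proof -
  have pc: "proper_edge_coloring E c 6" using ac by (simp add: acyclic_edge_coloring_def)
  have disj: "S1 \<inter> S2 = {}" using S1(1) cols(1) by blast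
  have finS: "finite S1" using S1(2) card.infinite by fastforce
  obtain x where x: "{u1, x} \<in> E" "c {u1, x} = b"
    using colors_atE[OF card2] b(1) cols(1) by metis
  obtain y where y: "{u1, y} \<in> E" "c {u1, y} = b'"
    using colors_atE[OF card2] b(2) cols(1) by metis
  have xy: "x \<noteq> y" using x y b(3) by blast
  \<comment> \<open>The three chains all enter \<open>u1\<close> through \<open>z\<close>, each
    after an edge of its own colour \<open>r\<close>. Together with \<open>a\<close> these are four
    colours at \<open>z\<close>, hence all of them.\<close>
  have full: "colors_at E c z = insert a S1"
    if z: "{u1, z} \<in> E" "c {u1, z} = a" "a \<in> S2"
      and ra: "\<And>r. r \<in> S1 \<Longrightarrow> (u2, u1) \<in> (alt_step E c r a)\<^sup>*" for z a
  proof -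
    have "r \<in> colors_at E c z" if r: "r \<in> S1" for r
    proof -
      have "u2 \<noteq> u1" using dist by auto
      then obtain w where "(w, u1) \<in> alt_step E c r a"
        using ra[OF r] by (meson rtranclE)
      then obtain z' where z': "{w, z'} \<in> E" "c {w, z'} = r" "{z', u1} \<in> E" "c {z', u1} = a"
        by (auto simp: alt_step_def)
      then have "z' = z" using proper_edge_inj[OF pc, of u1 z' z] z by (simp add: insert_commute)
      then show ?thesis using z' colors_atI(2) by metis
    qed
    then have "insert a S1 \<subseteq> colors_at E c z" using z colors_atI(2)[of u1 z E c] by auto
    moreover have "a \<notin> S1" using z(3) disj by blast
    then have "card (insert a S1) = 4" using S1(2) finS by simp
    ultimately show ?thesis
      using card_colors_at_le[OF fin, of c z] deg(1)[of z] finite_colors_at[OF fin, of c z]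
      by (metis card_seteq le_trans)
  qed
  have cx: "colors_at E c x = insert b S1" and cy: "colors_at E c y = insert b' S1"
    using full[OF x b(1) reach(1)] full[OF y b(2) reach(2)] by auto
  \<comment> \<open>As \<open>x\<close> and \<open>y\<close> see four colours, neither is
    \<open>u2\<close> or \<open>u3\<close>, whose colours thus survive the exchange.\<close>
  have away: "w \<noteq> x" "w \<noteq> y" if "card (colors_at E c w) \<le> 3" for w
    using that cx cy b disj S1(2) finS by auto
  have far3: "u3 \<noteq> x" "u3 \<noteq> y"
    using away card_colors_at_le[OF fin, of c u3] deg(2) by auto
  have far2: "u2 \<noteq> x" "u2 \<noteq> y" using away cols(2) S1(2) by auto
  let ?c = "swap_at u1 x y c"
  have ac': "acyclic_edge_coloring E ?c 6"
  proof (rule acyclic_swap_at[OF ac xy x(1) y(1)])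
    fix e assume e: "e \<in> E" "u1 \<notin> e" "x \<in> e \<or> y \<in> e"
    have "c e \<noteq> b \<and> c e \<in> insert b S1" if "x \<in> e"
    proof -
      have "e \<noteq> {u1, x}" "e \<inter> {u1, x} \<noteq> {}" using e that by auto
      then have "c e \<noteq> c {u1, x}"
        using proper_edge_neq[OF pc e(1) x(1)] by blast
      moreover have "c e \<in> colors_at E c x" using e that by (simp add: colors_at_def)
      ultimately show ?thesis using cx x(2) by simp
    qed
    moreover have "c e \<noteq> b' \<and> c e \<in> insert b' S1" if "y \<in> e"
    proof -
      have "e \<noteq> {u1, y}" "e \<inter> {u1, y} \<noteq> {}" using e that by auto
      then have "c e \<noteq> c {u1, y}"
        using proper_edge_neq[OF pc e(1) y(1)] by blast
      moreover have "c e \<in> colors_at E c y" using e that by (simp add: colors_at_def)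
      ultimately show ?thesis using cy y(2) by simp
    qed
    ultimately show "c e \<notin> colors_at E c u1" using e(3) cols(1) disj by blast
  qed
  note keep = colors_at_swap_at[OF xy x(1) y(1), where c = c]
  have keep1: "colors_at E ?c u1 = S2" using keep(1) cols by simp
  have keep2: "colors_at E ?c u2 = S1" using keep(2)[of u2] cols far2 dist by auto
  have keep3: "colors_at E ?c u3 = colors_at E c u3" using keep(2)[of u3] far3 dist by auto
  have broken: "(u2, t) \<notin> (alt_step E ?c r b)\<^sup>*"
    if "r \<in> S1" "r \<notin> colors_at E c t" for r t
    using swap_at_breaks_reach[OF pc xy x(1) y(1), of u2 r t] reach(1)[OF that(1)] that
      x(2) cy b disj dist cols(1) by auto
  obtain a1 a3 where a: "a1 \<in> S1 - colors_at E c u3" "a3 \<in> S1 - colors_at E c u3" "a1 \<noteq> a3"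
    using meet by (metis card_le_Suc0_iff_eq finS finite_Diff not_less_eq_eq numeral_2_eq_2)
  show ?thesis
  proof (rule extendable_tripleI[OF ac' dist, of a1 b a3])
    show "distinct [a1, b, a3]" using a b disj by auto
    show "a1 \<in> {..<6} - colors_at E ?c u1" "b \<in> {..<6} - colors_at E ?c u2"
      "a3 \<in> {..<6} - colors_at E ?c u3"
      using keep1 keep2 keep3 a b S1 S2 disj by auto
    show "(u2, u1) \<notin> (alt_step E ?c a1 b)\<^sup>*" "(u2, u3) \<notin> (alt_step E ?c a3 b)\<^sup>*"
      using broken a cols(1) disj by blast+
    show "(u3, u1) \<notin> (alt_step E ?c a1 a3)\<^sup>*"
      using alt_reach_colors(1)[of u3 u1 E ?c a1 a3] dist a keep3 by auto
  qed
qed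

lemma extendable_disjoint:
  assumes card2: "\<forall>e\<in>E. card e = 2" and fin: "finite E"
    and deg: "\<And>v. degree E v \<le> 4" "degree E u1 \<le> 3" "degree E u3 \<le> 3"
    and ac: "acyclic_edge_coloring E c 6"
    and dist: "distinct [u1, u2, u3]"
    and S1: "S1 = {..<6} - colors_at E c u1" "3 \<le> card S1"
    and S2: "S2 = {..<6} - colors_at E c u2" "3 \<le> card S2"
    and S3: "S3 = {..<6} - colors_at E c u3" "3 \<le> card S3"
    and disj: "S1 \<inter> S2 = {}"
    and meet: "2 \<le> card (S1 \<inter> S3)"
  shows "extendable E {u1, u2, u3}"
proof (rule ccontr)
  assume not_ext: "\<not> ?thesis"
  have pc: "proper_edge_coloring E c 6" using ac by (simp add: acyclic_edge_coloring_def)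
  have lt6: "colors_at E c w \<subseteq> {..<6}" for w
    using pc by (auto simp: colors_at_def proper_edge_coloring_def)
  have finS: "finite S1" "finite S2" "finite S3" using S1 S2 S3 by auto
  have "card (S1 \<union> S2) = card S1 + card S2" using finS disj by (intro card_Un_disjoint) auto
  moreover have sub: "S1 \<union> S2 \<subseteq> {..<6}" using S1 S2 by auto
  moreover have "card (S1 \<union> S2) \<le> 6" using card_mono[OF _ sub] by simp
  ultimately have c1: "card S1 = 3" and c2: "card S2 = 3" and "card (S1 \<union> S2) = card {..<6::nat}"
    using S1(2) S2(2) by auto
  then have un: "S1 \<union> S2 = {..<6}" using sub by (intro card_subset_eq) auto
  have cols: "colors_at E c u1 = S2" "colors_at E c u2 = S1"
    using un disj S1(1) S2(1) lt6[of u1] lt6[of u2] by auto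
  define L where "L r b t \<longleftrightarrow> (u2, t) \<in> (alt_step E c r b)\<^sup>*" for r b t
  \<comment> \<open>The last premise excludes a chain between \<open>u1\<close> and
    \<open>u3\<close>, since one end lacks the colour needed there. What remains are chains from
    \<open>u2\<close>; one ending at \<open>u3\<close> uses \<open>a2\<close> there.\<close>
  have blocked: "L a1 a2 u1 \<or> a2 \<notin> S3 \<and> L a3 a2 u3"
    if "a1 \<in> S1" "a2 \<in> S2" "a3 \<in> S3" "a1 \<noteq> a3" "a2 \<noteq> a3" "a1 \<in> S3 \<or> a3 \<in> S1" for a1 a2 a3
  proof (rule ccontr)
    assume no: "\<not> ?thesis"
    have 13: "(u3, u1) \<notin> (alt_step E c a1 a3)\<^sup>*"
      using alt_reach_colors[of u3 u1 E c a1 a3] dist that(6) S1(1) S3(1) by auto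
    have "(u2, u3) \<notin> (alt_step E c a3 a2)\<^sup>*"
      using alt_reach_colors[of u2 u3 E c a3 a2] dist no S3(1) by (auto simp: L_def)
    moreover have "distinct [a1, a2, a3]" using that disj by auto
    ultimately show False
      using extendable_tripleI[OF ac dist, of a1 a2 a3] not_ext no 13 that S1 S2 S3
      by (auto simp: L_def)
  qed
  \<comment> \<open>A chain whose colour \<open>r\<close> is missing at both \<open>u1\<close> and
    \<open>u3\<close> is stuck at either.\<close>
  have only: "\<not> (L r b u1 \<and> L r b u3)" if "r \<in> S1" "r \<in> S3" for r b
    using alt_reach_unique[OF pc, of u2 u1 r b u3] not_Domain_alt_step[of r E c] that S1(1) S3(1) dist
    by (auto simp: L_def)
  obtain d d' where d: "d \<in> S1 \<inter> S3" "d' \<in> S1 \<inter> S3" "d \<noteq> d'"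
    using meet finS by (metis card_le_Suc0_iff_eq finite_Int not_less_eq_eq numeral_2_eq_2)
  \<comment> \<open>If some common colour \<open>q\<close> on the edge to \<open>u3\<close> causes
    no conflict with \<open>b\<close>, every other \<open>r\<close> must lead to \<open>u1\<close>,
    and so must \<open>q\<close>, by giving \<open>u3\<close> a second common colour
    \<open>q'\<close>. Otherwise all common colours lead to \<open>u3\<close>, which forces
    \<open>S3 = S1\<close>.\<close>
  have column: "(\<forall>r\<in>S1. L r b u1) \<or> S3 = S1 \<and> (\<forall>r\<in>S1. L r b u3)" if b: "b \<in> S2" for b
  proof (cases "\<exists>r\<in>S1 \<inter> S3. b \<in> S3 \<or> \<not> L r b u3")
    case True
    then obtain q where q: "q \<in> S1" "q \<in> S3" "b \<in> S3 \<or> \<not> L q b u3" by blast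
    have others: "L r b u1" if "r \<in> S1" "r \<noteq> q" for r
      using blocked[of r b q] that q b disj by blast
    obtain q' where q': "q' \<in> S1" "q' \<in> S3" "q' \<noteq> q" using d by blast
    have "L q b u1"
      using blocked[of q b q'] q q' b disj others[of q'] only[of q' b] by blast
    with others show ?thesis by blast
  next
    case False
    then have bS3: "b \<notin> S3" and L3: "\<And>r. r \<in> S1 \<Longrightarrow> r \<in> S3 \<Longrightarrow> L r b u3" using d by blast+
    have "S3 \<subseteq> S1"
    proof
      fix a assume a: "a \<in> S3"
      show "a \<in> S1"
      proof (rule ccontr)
        assume "a \<notin> S1"
        \<comment> \<open>All colours at \<open>u2\<close> lie in \<open>S1\<close>, so no chain
          leaves it with \<open>a\<close>. The failure of \<open>d\<close>, \<open>b\<close>,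
          \<open>a\<close> then sends the \<open>d\<close>-chain to \<open>u1\<close>, though it
          ends at \<open>u3\<close>.\<close>
        then have "\<not> L a b u3"
          using alt_reach_colors(1)[of u2 u3 E c a b] dist cols(2) by (auto simp: L_def)
        moreover have "d \<noteq> a" "b \<noteq> a" using d a bS3 \<open>a \<notin> S1\<close> by auto
        ultimately have "L d b u1" using blocked[of d b a] d b a by blast
        then show False using only[of d b] L3 d by blast
      qed
    qed
    then have "S3 = S1" using c1 S3(2) finS(1) by (intro card_seteq) auto
    then show ?thesis using L3 by blast
  qed
  have one: "\<not> ((\<forall>r\<in>S1. L r b u1) \<and> (\<forall>r\<in>S1. L r b' u1))" if "b \<in> S2" "b' \<in> S2" "b \<noteq> b'" for b b'
  proof -
    have "S1 - colors_at E c u3 = S1 \<inter> S3" using S1(1) S3(1) by auto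
    then show ?thesis
      using extendable_by_swap[OF card2 fin deg(1,3) ac dist S1(1) c1 S2(1) c2 cols _ that]
        not_ext meet by (auto simp: L_def)
  qed
  \<comment> \<open>With \<open>S3 = S1\<close> the roles of \<open>u1\<close> and \<open>u3\<close>
    can be interchanged, so the exchange is made at \<open>u3\<close>.\<close>
  have three: "\<not> ((\<forall>r\<in>S1. L r b u3) \<and> (\<forall>r\<in>S1. L r b' u3))"
    if "b \<in> S2" "b' \<in> S2" "b \<noteq> b'" "S3 = S1" for b b'
  proof -
    have "colors_at E c u3 = S2" using that(4) lt6[of u3] S3(1) un disj by auto
    moreover have "S1 - colors_at E c u1 = S1" "distinct [u3, u2, u1]" using S1(1) dist by auto
    ultimately show ?thesis
      using extendable_by_swap[OF card2 fin deg(1,2) ac _ S3(1)[unfolded that(4)] c1 S2(1) c2 _ cols(2) _ that(1-3)]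
        not_ext c1 by (auto simp: L_def insert_commute)
  qed
  obtain b1 b2 b3 where b: "b1 \<in> S2" "b2 \<in> S2" "b3 \<in> S2" "b1 \<noteq> b2" "b1 \<noteq> b3" "b2 \<noteq> b3"
    using c2 by (auto simp: card_3_iff)
  show False
    using column[OF b(1)] column[OF b(2)] column[OF b(3)]
      one[OF b(1,2,4)] one[OF b(1,3,5)] one[OF b(2,3,6)]
      three[OF b(1,2,4)] three[OF b(1,3,5)] three[OF b(2,3,6)] by argo
qed

text \<open>No chain arises if in each pair one chosen colour is also missing at the other vertex.
  Such colours come from the pairwise intersections or, if all three sets share \<open>a\<close>,
  from \<open>a\<close> and a second colour common to two sets.\<close>

lemma extendable_pairwise_meeting:
  assumes ac: "acyclic_edge_coloring E c 6"
    and dist: "distinct [u1, u2, u3]"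
    and S1: "S1 = {..<6} - colors_at E c u1" "3 \<le> card S1"
    and S2: "S2 = {..<6} - colors_at E c u2" "3 \<le> card S2"
    and S3: "S3 = {..<6} - colors_at E c u3" "3 \<le> card S3"
    and meet: "S1 \<inter> S2 \<noteq> {}" "S2 \<inter> S3 \<noteq> {}" "S1 \<inter> S3 \<noteq> {}"
  shows "extendable E {u1, u2, u3}"
proof -
  have pick: "extendable E {u1, u2, u3}"
    if "distinct [a1, a2, a3]" "a1 \<in> S1" "a2 \<in> S2" "a3 \<in> S3"
      "a1 \<in> S2 \<or> a2 \<in> S1" "a1 \<in> S3 \<or> a3 \<in> S1" "a2 \<in> S3 \<or> a3 \<in> S2" for a1 a2 a3
    using that S1(1) S2(1) S3(1) dist
    by (intro extendable_tripleI[OF ac dist that(1)])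
      (use alt_reach_colors[of u2 u1 E c a1 a2] alt_reach_colors[of u3 u1 E c a1 a3]
        alt_reach_colors[of u2 u3 E c a3 a2] in auto)
  have finS: "finite S1" "finite S2" "finite S3" using S1 S2 S3 by auto
  show ?thesis
  proof (cases "S1 \<inter> S2 \<inter> S3 = {}")
    case True
    obtain a1 a2 a3 where "a1 \<in> S1 \<inter> S2" "a2 \<in> S2 \<inter> S3" "a3 \<in> S1 \<inter> S3" using meet by blast
    then show ?thesis using True pick[of a1 a2 a3] by auto
  next
    case False
    then obtain a where a: "a \<in> S1" "a \<in> S2" "a \<in> S3" by blast
    have big: "2 \<le> card (S - {a})" "finite (S - {a})" if "3 \<le> card S" "a \<in> S" for S :: "nat set"
      using that card.infinite by fastforce+
    have other: "\<exists>z\<in>S - {a}. z \<noteq> w" if "3 \<le> card S" "a \<in> S" for S :: "nat set" and w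
      using big[OF that] by (metis card_le_Suc0_iff_eq not_less_eq_eq numeral_2_eq_2)
    consider (12) z where "z \<in> S1 \<inter> S2" "z \<noteq> a" | (13) z where "z \<in> S1 \<inter> S3" "z \<noteq> a"
      | (23) z where "z \<in> S2 \<inter> S3" "z \<noteq> a"
    proof -
      \<comment> \<open>Otherwise the three sets without \<open>a\<close> would be disjoint, giving
        six colours among the remaining five.\<close>
      have False if no: "S1 \<inter> S2 \<subseteq> {a}" "S1 \<inter> S3 \<subseteq> {a}" "S2 \<inter> S3 \<subseteq> {a}"
      proof -
        let ?U = "(S1 - {a}) \<union> (S2 - {a}) \<union> (S3 - {a})"
        have "card ?U = card (S1 - {a}) + card (S2 - {a}) + card (S3 - {a})"
          using finS no by (subst card_Un_disjoint; (subst card_Un_disjoint)?) auto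
        then have "6 \<le> card ?U" using big(1)[OF S1(2) a(1)] big(1)[OF S2(2) a(2)] big(1)[OF S3(2) a(3)]
          by linarith
        moreover have "card ?U \<le> card ({..<6} - {a})" using S1(1) S2(1) S3(1) by (intro card_mono) auto
        moreover have "card ({..<6} - {a}) = 5" using a S1(1) by simp
        ultimately show False by linarith
      qed
      with that show ?thesis by blast
    qed
    \<comment> \<open>Colour \<open>a\<close> goes to the vertex outside the pair sharing
      \<open>z\<close>, \<open>z\<close> to one vertex of the pair, and any third colour of its own
      to the other.\<close>
    then show ?thesis
    proof cases
      case 12
      obtain t where "t \<in> S1 - {a}" "t \<noteq> z" using other[OF S1(2) a(1)] by blast
      then show ?thesis using pick[of t z a] 12 a by auto
    next
      case 13
      obtain t where "t \<in> S1 - {a}" "t \<noteq> z" using other[OF S1(2) a(1)] by blast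
      then show ?thesis using pick[of t a z] 13 a by auto
    next
      case 23
      obtain t where "t \<in> S2 - {a}" "t \<noteq> z" using other[OF S2(2) a(2)] by blast
      then show ?thesis using pick[of a t z] 23 a by auto
    qed
  qed
qed

text \<open>Each set of missing colours has at least three elements. Two disjoint ones exhaust the
  six colours, so the third shares two colours with one of them.\<close>

lemma extendable_triple:
  assumes card2: "\<forall>e\<in>E. card e = 2" and fin: "finite E"
    and deg: "\<And>v. degree E v \<le> 4"
      "degree E u1 \<le> 3" "degree E u2 \<le> 3" "degree E u3 \<le> 3"
    and ac: "acyclic_edge_coloring E c 6"
    and dist: "distinct [u1, u2, u3]"
  shows "extendable E {u1, u2, u3}"
proof -
  define S where "S w = {..<6} - colors_at E c w" for w
  have finS: "finite (S w)" for w by (simp add: S_def)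
  have big: "3 \<le> card (S w)" if "degree E w \<le> 3" for w
    using diff_card_le_card_Diff[OF finite_colors_at[OF fin, of c w], of "{..<6}"]
      card_colors_at_le[OF fin, of c w] that by (simp add: S_def)
  have disjoint: "extendable E {w1, w2, w3}"
    if w: "distinct [w1, w2, w3]" "degree E w1 \<le> 3" "degree E w2 \<le> 3" "degree E w3 \<le> 3"
      "S w1 \<inter> S w2 = {}" for w1 w2 w3
  proof -
    have sub: "S w1 \<union> S w2 \<subseteq> {..<6}" by (auto simp: S_def)
    have c: "card (S w1 \<union> S w2) = card (S w1) + card (S w2)"
      using finS w(5) by (intro card_Un_disjoint) auto
    have "card (S w1 \<union> S w2) = card {..<6::nat}"
      using c card_mono[OF _ sub] big[OF w(2)] big[OF w(3)] by simp
    then have un: "S w1 \<union> S w2 = {..<6}" using sub by (intro card_subset_eq) auto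
    have "S w3 = (S w1 \<inter> S w3) \<union> (S w2 \<inter> S w3)" using un by (auto simp: S_def)
    then have "card (S w3) \<le> card (S w1 \<inter> S w3) + card (S w2 \<inter> S w3)"
      by (metis card_Un_le)
    then consider "2 \<le> card (S w1 \<inter> S w3)" | "2 \<le> card (S w2 \<inter> S w3)"
      using big[OF w(4)] by linarith
    then show ?thesis
    proof cases
      case 1
      then show ?thesis
        using extendable_disjoint[OF card2 fin deg(1) w(2,4) ac w(1) S_def _ S_def _ S_def _ w(5)]
          big w by blast
    next
      case 2
      have "distinct [w2, w1, w3]" "S w2 \<inter> S w1 = {}" using w by auto
      with 2 have "extendable E {w2, w1, w3}"
        using extendable_disjoint[OF card2 fin deg(1) w(3,4) ac _ S_def _ S_def _ S_def _]
          big w by blast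
      then show ?thesis by (simp add: insert_commute)
    qed
  qed
  consider "S u1 \<inter> S u2 = {}" | "S u1 \<inter> S u3 = {}" | "S u2 \<inter> S u3 = {}"
    | "S u1 \<inter> S u2 \<noteq> {}" "S u2 \<inter> S u3 \<noteq> {}" "S u1 \<inter> S u3 \<noteq> {}" by blast
  then show ?thesis
  proof cases
    case 1
    then show ?thesis using disjoint dist deg by blast
  next
    case 2
    then have "extendable E {u1, u3, u2}" using disjoint[of u1 u3 u2] dist deg by auto
    then show ?thesis by (simp add: insert_commute)
  next
    case 3
    then have "extendable E {u2, u3, u1}" using disjoint[of u2 u3 u1] dist deg by auto
    then show ?thesis by (simp add: insert_commute)
  next
    case 4
    then show ?thesis
      using extendable_pairwise_meeting[OF ac dist S_def _ S_def _ S_def] big deg by blast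
  qed
qed

section \<open>Induction for 3-degenerate graphs\<close>

text \<open>Induction over edge sets: removing a vertex drops its edges and leaves it isolated. The
  lower degree bound makes the edge set shrink, and the last premise passes to subsets.\<close>

lemma acyclic_edge_coloring_degenerate:
  assumes "finite E" "\<forall>e\<in>E. card e = 2" "\<And>v. degree E v \<le> 4"
    and "\<And>F. F \<subseteq> E \<Longrightarrow> F \<noteq> {} \<Longrightarrow> \<exists>v. 1 \<le> degree F v \<and> degree F v \<le> 3"
  shows "\<exists>c. acyclic_edge_coloring E c 6"
  using assms
proof (induction E rule: finite_psubset_induct)
  case (psubset E)
  note card2 = psubset.prems(1) and deg = psubset.prems(2)
  show ?case
  proof (cases "E = {}")
    case True
    have "\<not> is_cycle {} xs" for xs :: "'a list"
      by (cases xs) (auto simp: is_cycle_def cycle_edges_def)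
    with True show ?thesis
      by (simp add: acyclic_edge_coloring_def proper_edge_coloring_def)
  next
    case False
    then obtain v where v: "1 \<le> degree E v" "degree E v \<le> 3" using psubset.prems(3) by blast
    let ?E' = "{e \<in> E. v \<notin> e}"
    let ?N = "{u. {v, u} \<in> E}"
    have le: "degree ?E' w \<le> degree E w" for w
      unfolding degree_def using psubset.hyps by (intro card_mono) auto
    have "{e \<in> E. v \<in> e} \<noteq> {}" using v(1) unfolding degree_def by force
    then have "?E' \<subset> E" by blast
    have card2': "\<forall>e\<in>?E'. card e = 2" and fin': "finite ?E'" using card2 psubset.hyps by auto
    have deg': "degree ?E' w \<le> 4" for w using le deg le_trans by blast
    have "\<exists>c. acyclic_edge_coloring ?E' c 6"
    proof (rule psubset.IH[OF \<open>?E' \<subset> E\<close> card2' deg'])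
      fix F assume "F \<subseteq> ?E'" "F \<noteq> {}"
      moreover from this have "F \<subseteq> E" by blast
      ultimately show "\<exists>v. 1 \<le> degree F v \<and> degree F v \<le> 3" using psubset.prems(3) by blast
    qed
    then obtain c where ac: "acyclic_edge_coloring ?E' c 6" by blast
    have img: "{e \<in> E. v \<in> e} = (\<lambda>u. {v, u}) ` ?N"
    proof (intro equalityI subsetI)
      fix e assume e: "e \<in> {e \<in> E. v \<in> e}"
      then have "card e = 2" using card2 by blast
      then obtain u where "e = {v, u}" using e unfolding card_2_iff by blast
      then show "e \<in> (\<lambda>u. {v, u}) ` ?N" using e by blast
    qed auto
    have inj: "inj_on (\<lambda>u. {v, u}) ?N" by (auto simp: inj_on_def doubleton_eq_iff)
    have cardN: "card ?N = degree E v" unfolding degree_def img by (rule card_image[OF inj, symmetric])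
    have finN: "finite ?N" using cardN v(1) card.infinite by fastforce
    have vN: "v \<notin> ?N" using card2 by fastforce
    \<comment> \<open>Losing the edge to \<open>v\<close> lowers the bound 4 to 3, which leaves
      three free colours.\<close>
    have degN: "degree ?E' u \<le> 3" if "u \<in> ?N" for u
    proof -
      have "{v, u} \<in> {e \<in> E. u \<in> e}" "{v, u} \<notin> {e \<in> ?E'. u \<in> e}" using that by auto
      moreover have "{e \<in> ?E'. u \<in> e} \<subseteq> {e \<in> E. u \<in> e}" by auto
      ultimately have "{e \<in> ?E'. u \<in> e} \<subset> {e \<in> E. u \<in> e}" by (metis psubsetI)
      then have "degree ?E' u < degree E u"
        unfolding degree_def using psubset.hyps by (intro psubset_card_mono) auto
      then show ?thesis using deg[of u] by linarith
    qed
    have degv: "degree ?E' v \<le> 3" and colv: "colors_at ?E' c v = {}"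
      by (auto simp: degree_def colors_at_def)
    consider u where "?N = {u}" | u1 u2 where "?N = {u1, u2}" "u1 \<noteq> u2"
      | u1 u2 u3 where "?N = {u1, u2, u3}" "distinct [u1, u2, u3]"
    proof -
      have "card ?N = 1 \<or> card ?N = 2 \<or> card ?N = 3" using cardN v by linarith
      then show ?thesis using that by (auto simp: card_1_singleton_iff card_2_iff card_3_iff)
    qed
    then have "\<exists>N. ?N \<subseteq> N \<and> extendable ?E' N"
    proof cases
      case (1 u)
      have "card (colors_at ?E' c u) \<le> 3"
        using card_colors_at_le[OF fin', of c u] degN[of u] 1 by auto
      then have "\<not> {..<6} \<subseteq> colors_at ?E' c u"
        using card_mono[OF finite_colors_at[OF fin', of c u], of "{..<6}"] by auto
      then obtain a where "a < 6" "a \<notin> colors_at ?E' c u" by auto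
      then have "extendable ?E' {u}" unfolding extendable_def using ac
        by (intro exI[of _ c] exI[of _ "\<lambda>_. a"]) auto
      then show ?thesis using 1 by (intro exI[of _ "{u}"]) auto
    next
      case (2 u1 u2)
      \<comment> \<open>\<open>v\<close> itself, isolated in \<open>?E'\<close>, serves as the missing third neighbour.\<close>
      have "distinct [u1, u2, v]" using 2 vN by auto
      then have "extendable ?E' {u1, u2, v}"
        using extendable_triple[OF card2' fin' deg' _ _ degv ac] degN 2 by blast
      then show ?thesis using 2(1) by (intro exI[of _ "{u1, u2, v}"]) auto
    next
      case (3 u1 u2 u3)
      then have "extendable ?E' {u1, u2, u3}"
        using extendable_triple[OF card2' fin' deg' _ _ _ ac] degN by blast
      then show ?thesis using 3(1) by (intro exI[of _ "{u1, u2, u3}"]) auto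
    qed
    then show ?thesis using acyclic_edge_coloring_extend[OF card2] by blast
  qed
qed

section \<open>Degeneracy of sparse connected graphs\<close>

lemma sum_degree:
  assumes "simple_graph V E"
  shows "(\<Sum>v\<in>V. degree E v) = 2 * card E"
proof -
  have fin: "finite V" "finite E"
    using assms finite_subset[of E "Pow V"] by (auto simp: simple_graph_def)
  have "card {v \<in> V. v \<in> e} = 2" if "e \<in> E" for e
  proof -
    have "{v \<in> V. v \<in> e} = e" using assms that by (auto simp: simple_graph_def)
    then show ?thesis using assms that by (simp add: simple_graph_def)
  qed
  then show ?thesis
    unfolding degree_def using sum_multicount[OF fin(1,2), of "(\<in>)" 2] by simp
qed

theorem theorem1:
  fixes V :: "'a set" and E :: "'a set set"
  assumes "simple_graph V E"
    and "connected_graph V E"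
    and "card E \<le> 2 * card V - 1"
    and "\<forall>v\<in>V. degree E v \<le> 4"
  shows "acyclic_chromatic_index V E \<le> 6"
proof -
  have finV: "finite V" and subV: "\<And>e. e \<in> E \<Longrightarrow> e \<subseteq> V" and card2: "\<forall>e\<in>E. card e = 2"
    using assms(1) by (auto simp: simple_graph_def)
  have finE: "finite E" using finite_subset[of E "Pow V"] finV subV by auto
  have deg: "degree E v \<le> 4" for v
  proof (cases "v \<in> V")
    case False
    then have "{e \<in> E. v \<in> e} = {}" using subV by blast
    then show ?thesis by (simp only: degree_def card.empty zero_le)
  qed (use assms(4) in blast)
  \<comment> \<open>If all vertices met by \<open>F\<close> had degree at least 4 in
    \<open>F\<close>, all their edges would lie in \<open>F\<close>. Following walks,
    \<open>F\<close> would meet every vertex, making the graph 4-regular with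
    \<open>2 * card V\<close> edges.\<close>
  have "\<exists>v. 1 \<le> degree F v \<and> degree F v \<le> 3" if F: "F \<subseteq> E" "F \<noteq> {}" for F
  proof (rule ccontr)
    assume no: "\<not> ?thesis"
    have finF: "finite F" using F finE finite_subset by blast
    have four: "degree F v = 4 \<and> {e \<in> E. v \<in> e} = {e \<in> F. v \<in> e}" if v: "v \<in> \<Union>F" for v
    proof -
      have "{e \<in> F. v \<in> e} \<noteq> {}" using v by blast
      then have "1 \<le> degree F v" unfolding degree_def using finF by (simp add: Suc_le_eq card_gt_0_iff)
      then have "\<not> degree F v \<le> 3" using no by blast
      then have ge: "4 \<le> degree F v" by linarith
      have sub: "{e \<in> F. v \<in> e} \<subseteq> {e \<in> E. v \<in> e}" using F by blast
      have eq: "{e \<in> F. v \<in> e} = {e \<in> E. v \<in> e}"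
        using card_seteq[OF _ sub] finE ge deg[of v] unfolding degree_def by simp
      then show ?thesis using ge deg[of v] unfolding degree_def by simp
    qed
    obtain e0 where e0: "e0 \<in> F" using F by blast
    then have "card e0 = 2" using card2 F by blast
    then obtain u where u: "u \<in> e0" by fastforce
    have "v \<in> \<Union>F" if v: "v \<in> V" for v
    proof -
      have "u \<in> V" using u e0 F subV by blast
      then obtain xs where xs: "is_walk E xs" "hd xs = u" "last xs = v"
        using assms(2) v unfolding connected_graph_def by blast
      have "xs ! i \<in> \<Union>F" if "i < length xs" for i
        using that
      proof (induction i)
        case 0
        then show ?case using xs(2) u e0 by (auto simp: hd_conv_nth)
      next
        case (Suc i)
        then have "{xs ! i, xs ! Suc i} \<in> {e \<in> E. xs ! i \<in> e}"
          using xs(1) by (simp add: is_walk_def)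
        then have "{xs ! i, xs ! Suc i} \<in> F" using four[of "xs ! i"] Suc by auto
        then show ?case by blast
      qed
      from this[of "length xs - 1"] show ?thesis
        using xs(1,3) by (simp add: is_walk_def last_conv_nth)
    qed
    then have all: "degree E v = 4" if "v \<in> V" for v
      using four[of v] that unfolding degree_def by auto
    have "2 * card E = 4 * card V" using sum_degree[OF assms(1)] all by simp
    \<comment> \<open>Subtraction is truncated: only for nonempty \<open>V\<close> is
      \<open>2 * card V - 1\<close> less than \<open>2 * card V\<close>.\<close>
    moreover have "card V > 0" using u e0 F subV finV card_gt_0_iff by blast
    ultimately show False using assms(3) by linarith
  qed
  then obtain c where "acyclic_edge_coloring E c 6"
    using acyclic_edge_coloring_degenerate[OF finE card2 deg] by blast
  then show ?thesis unfolding acyclic_chromatic_index_def by (intro Least_le) blast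
qed

end
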